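(* Let $(L,T,R)$ be a quantum triad (in sup-lattices). Let $R\otimes_T L$ be the sup-lattice quotient of the sup-lattice tensor product $R\otimes L$ by the congruence generated by $(rt)\otimes l\sim r\otimes(tl)$ for all $r\in R$, $l\in L$, $t\in T$. Let $Q_0$ be $R\otimes_T L$ with the operations determined on pure tensors (and extended by preservation of arbitrary joins in each variable) by $$(r\otimes l)\,r' = r(lr'),\qquad l\,(r\otimes l') = (lr)l',$$ $$(r\otimes l)(r'\otimes l') = (r(lr'))\otimes l',\qquad rl = r\otimes l$$ for $r,r'\in R$, $l,l'\in L$ (these give, respectively, the left action $Q_0\times R\to R$, the right action $L\times Q_0\to L$, the multiplication $Q_0\times Q_0\to Q_0$, and the map $R\times L\to Q_0$). Then $Q_0$ is a solution of $(L,T,R)$.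
   Context: A sup-lattice is a complete lattice; morphisms of sup-lattices preserve arbitrary joins. A bimorphism $S\times S'\to S''$ is a map that preserves arbitrary joins in each variable separately; its values are written as products. A quantale is a sup-lattice with an associative bimorphism $Q\times Q\to Q$ (no unit is assumed). A left $Q$-module is a sup-lattice $M$ with a bimorphism $Q\times M\to M$ satisfying $(qq')m=q(q'm)$; right modules are analogous; a $(Q,Q')$-bimodule is a left $Q$-module and right $Q'$-module with $(qm)q'=q(mq')$. The tensor product $R\otimes L$ of sup-lattices is the quotient of the free sup-lattice on $R\times L$ by the congruence generated by $\bigvee(r_i,l)\sim(\bigvee r_i,l)$ and $\bigvee(r,l_i)\sim(r,\bigvee l_i)$; the class of $(r,l)$ is the pure tensor $r\otimes l$. A (quantum) triad $(L,T,R)$ consists of a quantale $T$, a right $T$-module $R$, a left $T$-module $L$, and a bimorphism $L\times R\to T$, $(l,r)\mapsto lr$, such that $(tl)r=t(lr)$ and $(lr)t=l(rt)$ for all $l\in L$, $r\in R$, $t\in T$. A solution of the triad $(L,T,R)$ is a quantale $Q$ together with a left action $Q\times R\to R$ making $R$ a $(Q,T)$-bimodule, a right action $L\times Q\to L$ making $L$ a $(T,Q)$-bimodule, and a bimorphism $R\times L\to Q$, $(r,l)\mapsto rl$, such that for all $q\in Q$, $t\in T$, $r,r'\in R$, $l,l'\in L$: $(qr)l=q(rl)$, $(rl)q=r(lq)$, $(rt)l=r(tl)$, $(lq)r=l(qr)$, $(rl)r'=r(lr')$, $(lr)l'=l(rl')$. *)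

theory Defs
  imports "HOL-Algebra.Complete_Lattice"
begin

section \<open>Sup-lattices, quantales and modules\<close>

text \<open>A sup-lattice is rendered by the locale \<^locale>\<open>complete_lattice\<close> of HOL-Algebra.  All structures
  are carrier-based, because the carrier of the tensor product over \<open>T\<close> depends on the actions.\<close>

text \<open>Preservation of all joins includes the empty join, so bottom elements are preserved.\<close>

definition bimorphism :: "'a gorder \<Rightarrow> 'b gorder \<Rightarrow> 'c gorder \<Rightarrow> ('a \<Rightarrow> 'b \<Rightarrow> 'c) \<Rightarrow> bool" where
  "bimorphism A B C f \<longleftrightarrow>
     (\<forall>a\<in>carrier A. \<forall>b\<in>carrier B. f a b \<in> carrier C) \<and>
     (\<forall>X b. X \<subseteq> carrier A \<longrightarrow> b \<in> carrier B \<longrightarrow>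
        f (\<Squnion>\<^bsub>A\<^esub> X) b = \<Squnion>\<^bsub>C\<^esub> ((\<lambda>a. f a b) ` X)) \<and>
     (\<forall>a Y. a \<in> carrier A \<longrightarrow> Y \<subseteq> carrier B \<longrightarrow>
        f a (\<Squnion>\<^bsub>B\<^esub> Y) = \<Squnion>\<^bsub>C\<^esub> ((\<lambda>b. f a b) ` Y))"

locale quantale = complete_lattice Q
  for Q :: "'q gorder" +
  fixes QQ :: "'q \<Rightarrow> 'q \<Rightarrow> 'q"
  assumes mult_bimorphism: "bimorphism Q Q Q QQ"
    and mult_assoc: "\<lbrakk>a \<in> carrier Q; b \<in> carrier Q; c \<in> carrier Q\<rbrakk>
          \<Longrightarrow> QQ (QQ a b) c = QQ a (QQ b c)"

locale left_module = Q: quantale Q QQ + M: complete_lattice M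
  for Q :: "'q gorder" and QQ :: "'q \<Rightarrow> 'q \<Rightarrow> 'q" and M :: "'m gorder" +
  fixes QM :: "'q \<Rightarrow> 'm \<Rightarrow> 'm"
  assumes left_action_bimorphism: "bimorphism Q M M QM"
    and left_action_assoc: "\<lbrakk>q \<in> carrier Q; q' \<in> carrier Q; m \<in> carrier M\<rbrakk>
          \<Longrightarrow> QM (QQ q q') m = QM q (QM q' m)"

locale right_module = Q: quantale Q QQ + M: complete_lattice M
  for Q :: "'q gorder" and QQ :: "'q \<Rightarrow> 'q \<Rightarrow> 'q" and M :: "'m gorder" +
  fixes MQ :: "'m \<Rightarrow> 'q \<Rightarrow> 'm"
  assumes right_action_bimorphism: "bimorphism M Q M MQ"
    and right_action_assoc: "\<lbrakk>m \<in> carrier M; q \<in> carrier Q; q' \<in> carrier Q\<rbrakk>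
          \<Longrightarrow> MQ m (QQ q q') = MQ (MQ m q) q'"

locale bimodule = left: left_module P PP M PM + right: right_module Q QQ M MQ
  for P :: "'p gorder" and PP :: "'p \<Rightarrow> 'p \<Rightarrow> 'p"
    and Q :: "'q gorder" and QQ :: "'q \<Rightarrow> 'q \<Rightarrow> 'q"
    and M :: "'m gorder" and PM :: "'p \<Rightarrow> 'm \<Rightarrow> 'm" and MQ :: "'m \<Rightarrow> 'q \<Rightarrow> 'm" +
  assumes actions_commute: "\<lbrakk>p \<in> carrier P; m \<in> carrier M; q \<in> carrier Q\<rbrakk>
          \<Longrightarrow> MQ (PM p m) q = PM p (MQ m q)"


section \<open>Triads and their solutions\<close>

text \<open>A product is named after the structures its arguments come from; for instance
  \<open>TL t l\<close> is the element \<open>tl\<close> of \<open>L\<close>, \<open>LR l r\<close> the element \<open>lr\<close> of \<open>T\<close>, and \<open>TT\<close> is the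
  multiplication of \<open>T\<close>.\<close>

locale quantum_triad =
  R: right_module T TT R RT + L: left_module T TT L TL
  for L :: "'l gorder" and T :: "'t gorder" and R :: "'r gorder"
    and TT :: "'t \<Rightarrow> 't \<Rightarrow> 't" and TL :: "'t \<Rightarrow> 'l \<Rightarrow> 'l" and RT :: "'r \<Rightarrow> 't \<Rightarrow> 'r" +
  fixes LR :: "'l \<Rightarrow> 'r \<Rightarrow> 't"
  assumes LR_bimorphism: "bimorphism L R T LR"
    and TL_LR: "\<lbrakk>l \<in> carrier L; r \<in> carrier R; t \<in> carrier T\<rbrakk>
          \<Longrightarrow> LR (TL t l) r = TT t (LR l r)"
    and LR_RT: "\<lbrakk>l \<in> carrier L; r \<in> carrier R; t \<in> carrier T\<rbrakk>
          \<Longrightarrow> TT (LR l r) t = LR l (RT r t)"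

locale triad_solution =
  quantum_triad L T R TT TL RT LR +
  R: bimodule Q QQ T TT R QR RT + L: bimodule T TT Q QQ L TL LQ
  for L :: "'l gorder" and T :: "'t gorder" and R :: "'r gorder"
    and TT :: "'t \<Rightarrow> 't \<Rightarrow> 't" and TL :: "'t \<Rightarrow> 'l \<Rightarrow> 'l" and RT :: "'r \<Rightarrow> 't \<Rightarrow> 'r"
    and LR :: "'l \<Rightarrow> 'r \<Rightarrow> 't"
    and Q :: "'q gorder" and QQ :: "'q \<Rightarrow> 'q \<Rightarrow> 'q"
    and QR :: "'q \<Rightarrow> 'r \<Rightarrow> 'r" and LQ :: "'l \<Rightarrow> 'q \<Rightarrow> 'l" +
  fixes RL :: "'r \<Rightarrow> 'l \<Rightarrow> 'q"
  assumes RL_bimorphism: "bimorphism R L Q RL"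
    and QR_RL: "\<lbrakk>q \<in> carrier Q; r \<in> carrier R; l \<in> carrier L\<rbrakk>
          \<Longrightarrow> RL (QR q r) l = QQ q (RL r l)"
    and RL_LQ: "\<lbrakk>q \<in> carrier Q; r \<in> carrier R; l \<in> carrier L\<rbrakk>
          \<Longrightarrow> QQ (RL r l) q = RL r (LQ l q)"
    and RT_TL: "\<lbrakk>r \<in> carrier R; t \<in> carrier T; l \<in> carrier L\<rbrakk>
          \<Longrightarrow> RL (RT r t) l = RL r (TL t l)"
    and LQ_QR: "\<lbrakk>l \<in> carrier L; q \<in> carrier Q; r \<in> carrier R\<rbrakk>
          \<Longrightarrow> LR (LQ l q) r = LR l (QR q r)"
    and RL_LR: "\<lbrakk>r \<in> carrier R; l \<in> carrier L; r' \<in> carrier R\<rbrakk>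
          \<Longrightarrow> QR (RL r l) r' = RT r (LR l r')"
    and LR_RL: "\<lbrakk>l \<in> carrier L; r \<in> carrier R; l' \<in> carrier L\<rbrakk>
          \<Longrightarrow> TL (LR l r) l' = LQ l (RL r l')"


section \<open>Congruences and quotients of sup-lattices\<close>

text \<open>The set \<open>P\<close> of related pairs plays the role of an indexed family \<open>x\<^sub>i \<theta> y\<^sub>i\<close>; repetitions in a
  family do not affect its joins.\<close>

definition sup_congruence :: "'a gorder \<Rightarrow> ('a \<times> 'a) set \<Rightarrow> bool" where
  "sup_congruence S \<theta> \<longleftrightarrow>
     equiv (carrier S) \<theta> \<and> (\<forall>P. P \<subseteq> \<theta> \<longrightarrow> (\<Squnion>\<^bsub>S\<^esub> (fst ` P), \<Squnion>\<^bsub>S\<^esub> (snd ` P)) \<in> \<theta>)"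

definition generated_congruence :: "'a gorder \<Rightarrow> ('a \<times> 'a) set \<Rightarrow> ('a \<times> 'a) set" where
  "generated_congruence S G = \<Inter>{\<theta>. sup_congruence S \<theta> \<and> G \<subseteq> \<theta>}"

text \<open>The order below is the one for which the projection onto classes preserves joins: if
  \<open>x \<squnion> y\<close> is congruent to \<open>y\<close>, then \<open>x\<close> lies below the element \<open>x \<squnion> y\<close> of the class of \<open>y\<close>.\<close>

definition quotient_lattice :: "'a gorder \<Rightarrow> ('a \<times> 'a) set \<Rightarrow> 'a set gorder" where
  "quotient_lattice S \<theta> =
     \<lparr>carrier = carrier S // \<theta>, eq = (=),
      le = (\<lambda>X Y. \<exists>x\<in>X. \<exists>y\<in>Y. x \<sqsubseteq>\<^bsub>S\<^esub> y)\<rparr>"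


section \<open>Tensor products\<close>

text \<open>The free sup-lattice on a set is its powerset, a generator \<open>x\<close> being the singleton of \<open>x\<close>;
  its joins are unions.\<close>

definition free_sup_lattice :: "'a set \<Rightarrow> 'a set gorder" where
  "free_sup_lattice X = \<lparr>carrier = Pow X, eq = (=), le = (\<subseteq>)\<rparr>"

text \<open>The left-hand sides of the relations are joins of generators in the free sup-lattice.\<close>

definition tensor_congruence ::
  "'r gorder \<Rightarrow> 'l gorder \<Rightarrow> (('r \<times> 'l) set \<times> ('r \<times> 'l) set) set" where
  "tensor_congruence R L =
     generated_congruence (free_sup_lattice (carrier R \<times> carrier L))
       ({((\<Union>r\<in>A. {(r, l)}), {(\<Squnion>\<^bsub>R\<^esub> A, l)}) | A l. A \<subseteq> carrier R \<and> l \<in> carrier L} \<union>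
        {((\<Union>l\<in>B. {(r, l)}), {(r, \<Squnion>\<^bsub>L\<^esub> B)}) | r B. r \<in> carrier R \<and> B \<subseteq> carrier L})"

definition tensor :: "'r gorder \<Rightarrow> 'l gorder \<Rightarrow> ('r \<times> 'l) set set gorder" where
  "tensor R L =
     quotient_lattice (free_sup_lattice (carrier R \<times> carrier L)) (tensor_congruence R L)"

definition pure_tensor :: "'r gorder \<Rightarrow> 'l gorder \<Rightarrow> 'r \<Rightarrow> 'l \<Rightarrow> ('r \<times> 'l) set set" where
  "pure_tensor R L r l = tensor_congruence R L `` {{(r, l)}}"

definition balanced_congruence ::
  "'r gorder \<Rightarrow> 't gorder \<Rightarrow> 'l gorder \<Rightarrow> ('r \<Rightarrow> 't \<Rightarrow> 'r) \<Rightarrow> ('t \<Rightarrow> 'l \<Rightarrow> 'l)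
    \<Rightarrow> (('r \<times> 'l) set set \<times> ('r \<times> 'l) set set) set" where
  "balanced_congruence R T L RT TL =
     generated_congruence (tensor R L)
       {(pure_tensor R L (RT r t) l, pure_tensor R L r (TL t l)) | r t l.
          r \<in> carrier R \<and> t \<in> carrier T \<and> l \<in> carrier L}"

definition balanced_tensor ::
  "'r gorder \<Rightarrow> 't gorder \<Rightarrow> 'l gorder \<Rightarrow> ('r \<Rightarrow> 't \<Rightarrow> 'r) \<Rightarrow> ('t \<Rightarrow> 'l \<Rightarrow> 'l)
    \<Rightarrow> ('r \<times> 'l) set set set gorder" where
  "balanced_tensor R T L RT TL =
     quotient_lattice (tensor R L) (balanced_congruence R T L RT TL)"

definition balanced_pure ::
  "'r gorder \<Rightarrow> 't gorder \<Rightarrow> 'l gorder \<Rightarrow> ('r \<Rightarrow> 't \<Rightarrow> 'r) \<Rightarrow> ('t \<Rightarrow> 'l \<Rightarrow> 'l)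
    \<Rightarrow> 'r \<Rightarrow> 'l \<Rightarrow> ('r \<times> 'l) set set set" where
  "balanced_pure R T L RT TL r l = balanced_congruence R T L RT TL `` {pure_tensor R L r l}"


section \<open>The operations on the tensor product over \<open>T\<close>\<close>

text \<open>The operations are specified by their values on pure tensors and by preservation of joins in
  each variable.  That such operations exist and are unique on the carriers is not built into the
  definition.\<close>

definition Q0_operations ::
  "'l gorder \<Rightarrow> 't gorder \<Rightarrow> 'r gorder \<Rightarrow> ('t \<Rightarrow> 'l \<Rightarrow> 'l) \<Rightarrow> ('r \<Rightarrow> 't \<Rightarrow> 'r) \<Rightarrow> ('l \<Rightarrow> 'r \<Rightarrow> 't)
    \<Rightarrow> (('r \<times> 'l) set set set \<Rightarrow> ('r \<times> 'l) set set set \<Rightarrow> ('r \<times> 'l) set set set)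
    \<Rightarrow> (('r \<times> 'l) set set set \<Rightarrow> 'r \<Rightarrow> 'r) \<Rightarrow> ('l \<Rightarrow> ('r \<times> 'l) set set set \<Rightarrow> 'l) \<Rightarrow> bool" where
  "Q0_operations L T R TL RT LR QQ QR LQ \<longleftrightarrow>
     (let Q0 = balanced_tensor R T L RT TL; pure = balanced_pure R T L RT TL in
       bimorphism Q0 R R QR \<and> bimorphism L Q0 L LQ \<and> bimorphism Q0 Q0 Q0 QQ \<and>
       (\<forall>r\<in>carrier R. \<forall>l\<in>carrier L. \<forall>r'\<in>carrier R.
          QR (pure r l) r' = RT r (LR l r')) \<and>
       (\<forall>l\<in>carrier L. \<forall>r\<in>carrier R. \<forall>l'\<in>carrier L.
          LQ l (pure r l') = TL (LR l r) l') \<and>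
       (\<forall>r\<in>carrier R. \<forall>l\<in>carrier L. \<forall>r'\<in>carrier R. \<forall>l'\<in>carrier L.
          QQ (pure r l) (pure r' l') = pure (RT r (LR l r')) l'))"

end

theory Submission
  imports Defs
begin

text \<open>A congruence generated by relations is contained in the kernel of every join-preserving map
  that respects the relations.  Hence balanced bimorphisms \<open>R \<times> L \<rightarrow> M\<close> extend to join-preserving
  maps on \<open>R \<otimes>\<^sub>T L\<close>, which are determined by their values on pure tensors because every element is
  a join of pure tensors.  The operations are such extensions, and each equation of a solution is
  an equality of join-preserving maps that is checked on pure tensors, one variable at a time.\<close>

section \<open>Join-preserving maps\<close>

text \<open>Three obstacles shape the argument. The order on a quotient compares some
  representatives of two classes, so not even transitivity is evident; passing to the largest
  element \<open>nu x\<close> of each class reduces order questions to \<open>S\<close>. An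
  extension to \<open>Q0\<close> that depends on a parameter is obtained by choosing one extension
  for each value of the parameter, and the choices say nothing about joins of parameters; uniqueness
  on pure tensors recovers this. Laws with several arguments in \<open>Q0\<close> would call for one
  reduction to pure tensors per argument; the formulas
  \<open>(r \<otimes> l) q = r \<otimes> (l q)\<close>, \<open>(t l) q = t (l q)\<close> and
  \<open>(l q) r = l (q r)\<close>, proved for arbitrary \<open>q\<close>, leave a single argument
  to reduce in each associativity law. The axioms are verified for any operations meeting the
  specification, not just for the constructed ones; a second interpretation of the same locale then
  yields uniqueness.\<close>

lemma (in partial_order) complete_lattice_if_sups:
  assumes sups: "\<And>A. A \<subseteq> carrier L \<Longrightarrow> \<exists>s. least L s (Upper L A)"
  shows "complete_lattice L"
proof
  fix A
  assume A: "A \<subseteq> carrier L"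
  \<comment> \<open>The infimum of \<open>A\<close> is the join of its lower bounds, so for
    powersets and quotients only joins have to be constructed.\<close>
  obtain s where s: "least L s (Upper L (Lower L A))"
    using sups[of "Lower L A"] by auto
  have "greatest L s (Lower L A)"
    using s A unfolding least_def greatest_def Upper_def Lower_def by blast
  then show "\<exists>i. greatest L i (Lower L A)" ..
qed (rule sups)

context complete_lattice
begin

lemma sup_eq_if_least: "\<lbrakk>least L s (Upper L A); A \<subseteq> carrier L\<rbrakk> \<Longrightarrow> \<Squnion>A = s"
  using supI[of A "\<lambda>x. x = s"] least_unique by metis

lemma sup_singleton: "x \<in> carrier L \<Longrightarrow> \<Squnion>{x} = x"
  by (rule sup_eq_if_least) (auto intro!: least_UpperI)

lemma sup_absorb:
  assumes "x \<in> carrier L" "y \<in> carrier L" "x \<sqsubseteq> y"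
  shows "\<Squnion>{x, y} = y"
  using assms by (intro sup_eq_if_least least_UpperI) (auto simp: Upper_def)

lemma sup_of_sups:
  assumes "\<And>i. i \<in> I \<Longrightarrow> A i \<subseteq> carrier L"
  shows "\<Squnion>((\<lambda>i. \<Squnion>(A i)) ` I) = \<Squnion>(\<Union>i\<in>I. A i)"
proof (rule le_antisym)
  have sub: "(\<lambda>i. \<Squnion>(A i)) ` I \<subseteq> carrier L" "(\<Union>i\<in>I. A i) \<subseteq> carrier L"
    using assms by auto
  then show "\<Squnion>((\<lambda>i. \<Squnion>(A i)) ` I) \<in> carrier L" "\<Squnion>(\<Union>i\<in>I. A i) \<in> carrier L"
    by simp_all
  show "\<Squnion>((\<lambda>i. \<Squnion>(A i)) ` I) \<sqsubseteq> \<Squnion>(\<Union>i\<in>I. A i)"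
  proof (rule sup_least)
    fix x
    assume "x \<in> (\<lambda>i. \<Squnion>(A i)) ` I"
    then obtain i where i: "i \<in> I" "x = \<Squnion>(A i)" by auto
    then show "x \<sqsubseteq> \<Squnion>(\<Union>i\<in>I. A i)"
      using sub assms by (auto intro!: sup_least intro: sup_upper)
  qed (use sub in auto)
  show "\<Squnion>(\<Union>i\<in>I. A i) \<sqsubseteq> \<Squnion>((\<lambda>i. \<Squnion>(A i)) ` I)"
  proof (rule sup_least)
    fix x
    assume "x \<in> (\<Union>i\<in>I. A i)"
    then obtain i where i: "i \<in> I" "x \<in> A i" by auto
    have "x \<sqsubseteq> \<Squnion>(A i)"
      using i assms by (intro sup_upper) auto
    moreover have "\<Squnion>(A i) \<sqsubseteq> \<Squnion>((\<lambda>i. \<Squnion>(A i)) ` I)"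
      using i sub by (intro sup_upper) auto
    ultimately show "x \<sqsubseteq> \<Squnion>((\<lambda>i. \<Squnion>(A i)) ` I)"
    proof (rule le_trans)
      show "x \<in> carrier L"
        using i assms by blast
    qed (use i assms sub in simp_all)
  qed (use sub in auto)
qed

text \<open>Both sides are the join of all \<open>g i j\<close>.\<close>

lemma sup_swap:
  assumes "\<And>i j. \<lbrakk>i \<in> I; j \<in> J\<rbrakk> \<Longrightarrow> g i j \<in> carrier L"
  shows "\<Squnion>((\<lambda>i. \<Squnion>(g i ` J)) ` I) = \<Squnion>((\<lambda>j. \<Squnion>((\<lambda>i. g i j) ` I)) ` J)"
proof -
  have "(\<Union>i\<in>I. g i ` J) = (\<Union>j\<in>J. (\<lambda>i. g i j) ` I)"
    by auto
  then show ?thesis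
    using assms by (subst (1 2) sup_of_sups) auto
qed

end

definition sup_hom :: "'a gorder \<Rightarrow> 'b gorder \<Rightarrow> ('a \<Rightarrow> 'b) \<Rightarrow> bool" where
  "sup_hom A B h \<longleftrightarrow> (\<forall>a\<in>carrier A. h a \<in> carrier B) \<and>
     (\<forall>X. X \<subseteq> carrier A \<longrightarrow> h (\<Squnion>\<^bsub>A\<^esub> X) = \<Squnion>\<^bsub>B\<^esub> (h ` X))"

lemma sup_hom_closed: "\<lbrakk>sup_hom A B h; a \<in> carrier A\<rbrakk> \<Longrightarrow> h a \<in> carrier B"
  by (simp add: sup_hom_def)

lemma sup_hom_sup: "\<lbrakk>sup_hom A B h; X \<subseteq> carrier A\<rbrakk> \<Longrightarrow> h (\<Squnion>\<^bsub>A\<^esub> X) = \<Squnion>\<^bsub>B\<^esub> (h ` X)"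
  by (simp add: sup_hom_def)

lemma sup_hom_comp:
  assumes "sup_hom A B f" "sup_hom B C g"
  shows "sup_hom A C (\<lambda>a. g (f a))"
proof -
  have "g (f (\<Squnion>\<^bsub>A\<^esub> X)) = \<Squnion>\<^bsub>C\<^esub> ((\<lambda>a. g (f a)) ` X)" if X: "X \<subseteq> carrier A" for X
  proof -
    have "f ` X \<subseteq> carrier B"
      using assms(1) X by (auto intro: sup_hom_closed)
    then show ?thesis
      using sup_hom_sup[OF assms(1) X] sup_hom_sup[OF assms(2)] by (simp add: image_image)
  qed
  then show ?thesis
    using assms by (simp add: sup_hom_def)
qed

text \<open>Joins commute with joins. This makes the join of a family of extensions a competitor to
  the extension at the join of the parameters.\<close>

lemma sup_hom_pointwise_sup:
  assumes "complete_lattice B" and h: "\<And>i. i \<in> I \<Longrightarrow> sup_hom A B (h i)"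
  shows "sup_hom A B (\<lambda>a. \<Squnion>\<^bsub>B\<^esub> ((\<lambda>i. h i a) ` I))"
proof -
  interpret B: complete_lattice B by fact
  have "\<Squnion>\<^bsub>B\<^esub> ((\<lambda>i. h i (\<Squnion>\<^bsub>A\<^esub> X)) ` I) = \<Squnion>\<^bsub>B\<^esub> ((\<lambda>a. \<Squnion>\<^bsub>B\<^esub> ((\<lambda>i. h i a) ` I)) ` X)"
    if X: "X \<subseteq> carrier A" for X
  proof -
    have "(\<lambda>i. h i (\<Squnion>\<^bsub>A\<^esub> X)) ` I = (\<lambda>i. \<Squnion>\<^bsub>B\<^esub> (h i ` X)) ` I"
      using h X by (intro image_cong) (auto simp: sup_hom_sup)
    also have "\<Squnion>\<^bsub>B\<^esub> \<dots> = \<Squnion>\<^bsub>B\<^esub> ((\<lambda>a. \<Squnion>\<^bsub>B\<^esub> ((\<lambda>i. h i a) ` I)) ` X)"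
      using h X by (intro B.sup_swap) (auto intro: sup_hom_closed)
    finally show ?thesis .
  qed
  then show ?thesis
    using h by (auto simp: sup_hom_def intro!: B.sup_closed)
qed

lemma bimorphism_flip: "bimorphism A B C f \<longleftrightarrow> bimorphism B A C (\<lambda>b a. f a b)"
  unfolding bimorphism_def by blast

lemma bimorphism_closed:
  "\<lbrakk>bimorphism A B C f; a \<in> carrier A; b \<in> carrier B\<rbrakk> \<Longrightarrow> f a b \<in> carrier C"
  by (simp add: bimorphism_def)

lemma bimorphism_hom_left: "\<lbrakk>bimorphism A B C f; b \<in> carrier B\<rbrakk> \<Longrightarrow> sup_hom A C (\<lambda>a. f a b)"
  by (simp add: bimorphism_def sup_hom_def)

lemma bimorphism_hom_right: "\<lbrakk>bimorphism A B C f; a \<in> carrier A\<rbrakk> \<Longrightarrow> sup_hom B C (f a)"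
  by (simp add: bimorphism_def sup_hom_def)

lemma bimorphismI:
  assumes "\<And>b. b \<in> carrier B \<Longrightarrow> sup_hom A C (\<lambda>a. f a b)"
    and "\<And>a. a \<in> carrier A \<Longrightarrow> sup_hom B C (f a)"
  shows "bimorphism A B C f"
  using assms unfolding bimorphism_def sup_hom_def by blast

section \<open>Quotients by generated congruences\<close>

text \<open>If all pairs of \<open>P\<close> lie in the kernel, the two projections of
  \<open>P\<close> have the same image under \<open>h\<close>, and a join depends only on the set
  that is joined.\<close>

lemma sup_congruence_kernel:
  assumes "complete_lattice S" and h: "sup_hom S M h"
  shows "sup_congruence S {(x, y). x \<in> carrier S \<and> y \<in> carrier S \<and> h x = h y}"
proof -
  interpret S: complete_lattice S by fact
  let ?K = "{(x, y). x \<in> carrier S \<and> y \<in> carrier S \<and> h x = h y}"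
  have "(\<Squnion>\<^bsub>S\<^esub> (fst ` P), \<Squnion>\<^bsub>S\<^esub> (snd ` P)) \<in> ?K" if P: "P \<subseteq> ?K" for P
  proof -
    have sub: "fst ` P \<subseteq> carrier S" "snd ` P \<subseteq> carrier S"
      using P by auto
    have "h ` fst ` P = h ` snd ` P"
      using P unfolding image_image by (intro image_cong) auto
    then show ?thesis
      using sub h by (simp add: sup_hom_sup)
  qed
  moreover have "equiv (carrier S) ?K"
    by (auto simp: equiv_def refl_on_def sym_def trans_def)
  ultimately show ?thesis
    by (simp add: sup_congruence_def)
qed

lemma sup_congruence_generated:
  assumes "complete_lattice S" "G \<subseteq> carrier S \<times> carrier S"
  shows "sup_congruence S (generated_congruence S G)"
proof -
  interpret S: complete_lattice S by fact
  let ?F = "{\<theta>. sup_congruence S \<theta> \<and> G \<subseteq> \<theta>}"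
  \<comment> \<open>The family being intersected must be nonempty: an empty intersection would be
    the universal relation on the type, which need not stay inside \<open>carrier S\<close>.\<close>
  have "sup_congruence S (carrier S \<times> carrier S)"
    by (auto simp: sup_congruence_def equiv_def refl_on_def sym_def trans_def
        intro!: S.sup_closed)
  with assms have full: "carrier S \<times> carrier S \<in> ?F" by simp
  have eqv: "equiv (carrier S) \<theta>" if "\<theta> \<in> ?F" for \<theta>
    using that by (simp add: sup_congruence_def)
  have "equiv (carrier S) (\<Inter>?F)"
  proof (rule equivI)
    show "\<Inter>?F \<subseteq> carrier S \<times> carrier S"
      using full by blast
    show "refl_on (carrier S) (\<Inter>?F)"
      using eqv by (auto simp: equiv_def refl_on_def)
    show "sym (\<Inter>?F)"
      using eqv by (intro symI) (auto simp: equiv_def dest: symD)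
    show "trans (\<Inter>?F)"
    proof (rule transI)
      fix x y z
      assume "(x, y) \<in> \<Inter>?F" "(y, z) \<in> \<Inter>?F"
      then show "(x, z) \<in> \<Inter>?F"
        using eqv unfolding equiv_def by (meson Inter_iff transD)
    qed
  qed
  moreover have "(\<Squnion>\<^bsub>S\<^esub> (fst ` P), \<Squnion>\<^bsub>S\<^esub> (snd ` P)) \<in> \<Inter>?F" if "P \<subseteq> \<Inter>?F" for P
    using that unfolding sup_congruence_def by blast
  ultimately show ?thesis
    by (simp add: sup_congruence_def generated_congruence_def)
qed

locale sup_quotient = S: complete_lattice S for S :: "'a gorder" +
  fixes \<theta> :: "('a \<times> 'a) set"
  assumes congruence: "sup_congruence S \<theta>"
begin

abbreviation "Qt \<equiv> quotient_lattice S \<theta>"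
abbreviation "cls x \<equiv> \<theta> `` {x}"

text \<open>The largest element of the class; the quotient is order-isomorphic to the set of these.\<close>

definition "nu x = \<Squnion>\<^bsub>S\<^esub> (cls x)"

lemma equiv: "equiv (carrier S) \<theta>"
  using congruence by (simp add: sup_congruence_def)

lemma cong_closed: "(x, y) \<in> \<theta> \<Longrightarrow> x \<in> carrier S \<and> y \<in> carrier S"
  using equiv by (auto simp: equiv_def)

lemma cls_subset: "cls x \<subseteq> carrier S"
  using cong_closed by auto

lemma nu_closed: "nu x \<in> carrier S"
  using cls_subset by (simp add: nu_def)

lemma cong_refl: "x \<in> carrier S \<Longrightarrow> (x, x) \<in> \<theta>"
  using equiv by (simp add: equiv_def refl_on_def)

lemma cong_sup: "P \<subseteq> \<theta> \<Longrightarrow> (\<Squnion>\<^bsub>S\<^esub> (fst ` P), \<Squnion>\<^bsub>S\<^esub> (snd ` P)) \<in> \<theta>"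
  using congruence by (simp add: sup_congruence_def)

lemma cls_eq_iff: "\<lbrakk>x \<in> carrier S; y \<in> carrier S\<rbrakk> \<Longrightarrow> cls x = cls y \<longleftrightarrow> (x, y) \<in> \<theta>"
  using equiv by (simp add: eq_equiv_class_iff)

text \<open>Closure under joins is applied to the pairs of \<open>x\<close> with each member of its
  class. The class is nonempty, so the join of the first components is \<open>x\<close> and not the
  bottom element.\<close>

lemma cong_nu:
  assumes x: "x \<in> carrier S"
  shows "(x, nu x) \<in> \<theta>"
proof -
  have "(\<Squnion>\<^bsub>S\<^esub> (fst ` ({x} \<times> cls x)), \<Squnion>\<^bsub>S\<^esub> (snd ` ({x} \<times> cls x))) \<in> \<theta>"
    by (rule cong_sup) auto
  moreover have "cls x \<noteq> {}"
    using x cong_refl by auto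
  ultimately show ?thesis
    using x by (simp add: nu_def S.sup_singleton)
qed

lemma le_nu: "(x, y) \<in> \<theta> \<Longrightarrow> y \<sqsubseteq>\<^bsub>S\<^esub> nu x"
  unfolding nu_def using cls_subset by (intro S.sup_upper) auto

lemma nu_eq: "(x, y) \<in> \<theta> \<Longrightarrow> nu x = nu y"
  using cls_eq_iff cong_closed by (metis nu_def)

text \<open>Joining the pairs \<open>(x, nu x)\<close> and \<open>(y, nu y)\<close> relates
  \<open>y\<close> to the join of \<open>nu x\<close> and \<open>nu y\<close>, because
  \<open>x\<close> lies below \<open>y\<close>; that join is then below the largest element of the
  class of \<open>y\<close>. With \<open>le_nu\<close> and \<open>nu_eq\<close> this makes
  \<open>nu\<close> a closure operator on \<open>S\<close>.\<close>

lemma nu_mono: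
  assumes x: "x \<in> carrier S" and y: "y \<in> carrier S" and le: "x \<sqsubseteq>\<^bsub>S\<^esub> y"
  shows "nu x \<sqsubseteq>\<^bsub>S\<^esub> nu y"
proof -
  have "(\<Squnion>\<^bsub>S\<^esub> (fst ` {(x, nu x), (y, nu y)}), \<Squnion>\<^bsub>S\<^esub> (snd ` {(x, nu x), (y, nu y)})) \<in> \<theta>"
    using x y cong_nu by (intro cong_sup) auto
  then have "(y, \<Squnion>\<^bsub>S\<^esub> {nu x, nu y}) \<in> \<theta>"
    using assms by (simp add: S.sup_absorb)
  then have "\<Squnion>\<^bsub>S\<^esub> {nu x, nu y} \<sqsubseteq>\<^bsub>S\<^esub> nu y"
    by (rule le_nu)
  moreover have "nu x \<sqsubseteq>\<^bsub>S\<^esub> \<Squnion>\<^bsub>S\<^esub> {nu x, nu y}"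
    using nu_closed by (intro S.sup_upper) auto
  ultimately show ?thesis
    using nu_closed by (meson S.le_trans S.sup_closed empty_subsetI insert_subset)
qed

lemma carrier_quotient: "carrier Qt = cls ` carrier S"
  by (auto simp: quotient_lattice_def quotient_def)

text \<open>The witnesses in the quotient order may change from one comparison to the next, which
  blocks a direct proof of transitivity or antisymmetry. Largest elements are canonical
  representatives, so both properties are inherited from \<open>S\<close>.\<close>

lemma cls_le_iff:
  assumes x: "x \<in> carrier S" and y: "y \<in> carrier S"
  shows "cls x \<sqsubseteq>\<^bsub>Qt\<^esub> cls y \<longleftrightarrow> nu x \<sqsubseteq>\<^bsub>S\<^esub> nu y"
proof
  assume "cls x \<sqsubseteq>\<^bsub>Qt\<^esub> cls y"
  then obtain x' y' where *: "(x, x') \<in> \<theta>" "(y, y') \<in> \<theta>" "x' \<sqsubseteq>\<^bsub>S\<^esub> y'"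
    by (auto simp: quotient_lattice_def)
  then have "nu x' \<sqsubseteq>\<^bsub>S\<^esub> nu y'"
    using cong_closed by (intro nu_mono) auto
  then show "nu x \<sqsubseteq>\<^bsub>S\<^esub> nu y"
    using * nu_eq by metis
next
  assume "nu x \<sqsubseteq>\<^bsub>S\<^esub> nu y"
  then show "cls x \<sqsubseteq>\<^bsub>Qt\<^esub> cls y"
    using cong_nu[OF x] cong_nu[OF y] by (auto simp: quotient_lattice_def)
qed

lemma nu_eq_imp: "\<lbrakk>x \<in> carrier S; y \<in> carrier S; nu x = nu y\<rbrakk> \<Longrightarrow> cls x = cls y"
  using cong_nu cls_eq_iff nu_closed by metis

lemma eq_quotient: "eq Qt = (=)"
  by (simp add: quotient_lattice_def)

lemma partial_order_quotient: "partial_order Qt"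
proof
  fix X Y Z
  assume "X \<in> carrier Qt" "Y \<in> carrier Qt" "Z \<in> carrier Qt"
  then obtain x y z where xyz: "x \<in> carrier S" "y \<in> carrier S" "z \<in> carrier S"
    "X = cls x" "Y = cls y" "Z = cls z"
    unfolding carrier_quotient by blast
  assume "X \<sqsubseteq>\<^bsub>Qt\<^esub> Y" "Y \<sqsubseteq>\<^bsub>Qt\<^esub> Z"
  then have "nu x \<sqsubseteq>\<^bsub>S\<^esub> nu y" "nu y \<sqsubseteq>\<^bsub>S\<^esub> nu z"
    using xyz by (simp_all add: cls_le_iff)
  then have "nu x \<sqsubseteq>\<^bsub>S\<^esub> nu z"
    by (rule S.le_trans) (rule nu_closed)+
  then show "X \<sqsubseteq>\<^bsub>Qt\<^esub> Z"
    using xyz by (simp add: cls_le_iff)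
next
  fix X Y
  assume "X \<in> carrier Qt" "Y \<in> carrier Qt"
  then obtain x y where xy: "x \<in> carrier S" "y \<in> carrier S" "X = cls x" "Y = cls y"
    unfolding carrier_quotient by blast
  assume "X \<sqsubseteq>\<^bsub>Qt\<^esub> Y" "Y \<sqsubseteq>\<^bsub>Qt\<^esub> X"
  then have "nu x \<sqsubseteq>\<^bsub>S\<^esub> nu y" "nu y \<sqsubseteq>\<^bsub>S\<^esub> nu x"
    using xy by (simp_all add: cls_le_iff)
  then have "nu x = nu y"
    by (rule S.le_antisym) (rule nu_closed)+
  then show "X .=\<^bsub>Qt\<^esub> Y"
    unfolding eq_quotient xy(3,4) using xy(1,2) by (intro nu_eq_imp)
qed (auto simp: eq_quotient carrier_quotient cls_le_iff nu_closed)

text \<open>A class \<open>cls y\<close> bounding all classes of \<open>X\<close> gives the bound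
  \<open>nu y\<close> of \<open>X\<close> in \<open>S\<close>, since \<open>x\<close> lies below
  \<open>nu x\<close>, which lies below \<open>nu y\<close>. Applying \<open>nu\<close> to the
  resulting bound on the join and using idempotence returns to the quotient.\<close>

lemma least_cls_sup:
  assumes X: "X \<subseteq> carrier S"
  shows "least Qt (cls (\<Squnion>\<^bsub>S\<^esub> X)) (Upper Qt (cls ` X))"
proof (rule least_UpperI)
  have sX: "\<Squnion>\<^bsub>S\<^esub> X \<in> carrier S"
    using X by simp
  show "c \<sqsubseteq>\<^bsub>Qt\<^esub> cls (\<Squnion>\<^bsub>S\<^esub> X)" if "c \<in> cls ` X" for c
    using that X sX by (auto simp: cls_le_iff subset_iff intro!: nu_mono S.sup_upper)
  show "cls (\<Squnion>\<^bsub>S\<^esub> X) \<sqsubseteq>\<^bsub>Qt\<^esub> c" if c: "c \<in> Upper Qt (cls ` X)" for c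
  proof -
    from c obtain y where y: "c = cls y" "y \<in> carrier S"
      unfolding Upper_def carrier_quotient by auto
    have "x \<sqsubseteq>\<^bsub>S\<^esub> nu y" if "x \<in> X" for x
    proof -
      have xS: "x \<in> carrier S" using that X by auto
      have "cls x \<sqsubseteq>\<^bsub>Qt\<^esub> cls y"
        using c that xS unfolding Upper_def y(1) carrier_quotient by auto
      then have "nu x \<sqsubseteq>\<^bsub>S\<^esub> nu y"
        using xS y by (simp add: cls_le_iff)
      then show ?thesis
        using le_nu[OF cong_refl[OF xS]] xS nu_closed by (meson S.le_trans)
    qed
    then have "\<Squnion>\<^bsub>S\<^esub> X \<sqsubseteq>\<^bsub>S\<^esub> nu y"
      using X nu_closed by (intro S.sup_least) auto
    then have "nu (\<Squnion>\<^bsub>S\<^esub> X) \<sqsubseteq>\<^bsub>S\<^esub> nu (nu y)"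
      using sX nu_closed by (intro nu_mono) auto
    then show ?thesis
      using y sX nu_eq[OF cong_nu[OF y(2)]] by (simp add: cls_le_iff)
  qed
qed (use X in \<open>auto simp: carrier_quotient\<close>)

lemma complete_lattice_quotient: "complete_lattice Qt"
proof -
  interpret Qt: partial_order Qt by (rule partial_order_quotient)
  show ?thesis
  proof (rule Qt.complete_lattice_if_sups)
    fix A
    assume "A \<subseteq> carrier Qt"
    then obtain X where "X \<subseteq> carrier S" "A = cls ` X"
      unfolding carrier_quotient by (rule subset_imageE)
    then show "\<exists>s. least Qt s (Upper Qt A)"
      using least_cls_sup by blast
  qed
qed

lemma sup_hom_cls: "sup_hom S Qt (\<lambda>x. cls x)"
proof -
  interpret Qt: complete_lattice Qt by (rule complete_lattice_quotient)
  have "cls (\<Squnion>\<^bsub>S\<^esub> X) = \<Squnion>\<^bsub>Qt\<^esub> (cls ` X)" if "X \<subseteq> carrier S" for X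
    using Qt.sup_eq_if_least[OF least_cls_sup[OF that]] that by (auto simp: carrier_quotient)
  then show ?thesis
    by (auto simp: sup_hom_def carrier_quotient)
qed

lemma induced_hom:
  assumes h: "sup_hom S M h" and resp: "\<And>x y. (x, y) \<in> \<theta> \<Longrightarrow> h x = h y"
  shows "\<exists>k. sup_hom Qt M k \<and> (\<forall>x\<in>carrier S. k (cls x) = h x)"
proof -
  \<comment> \<open>On a class the chosen representative does not matter, as \<open>h\<close> is
    constant there; outside the carrier the value is arbitrary.\<close>
  define k where "k c = h (SOME x. x \<in> c)" for c
  have k: "k (cls x) = h x" if "x \<in> carrier S" for x
  proof -
    have "(SOME y. y \<in> cls x) \<in> cls x"
      using cong_refl[OF that] by (intro someI[of "\<lambda>y. y \<in> cls x" x]) auto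
    then show ?thesis
      using resp by (auto simp: k_def)
  qed
  have "k (\<Squnion>\<^bsub>Qt\<^esub> A) = \<Squnion>\<^bsub>M\<^esub> (k ` A)" if A: "A \<subseteq> carrier Qt" for A
  proof -
    obtain X where X: "X \<subseteq> carrier S" "A = cls ` X"
      using A unfolding carrier_quotient by (rule subset_imageE)
    have "k (\<Squnion>\<^bsub>Qt\<^esub> A) = k (cls (\<Squnion>\<^bsub>S\<^esub> X))"
      using sup_hom_sup[OF sup_hom_cls X(1)] X by simp
    also have "\<dots> = \<Squnion>\<^bsub>M\<^esub> (h ` X)"
      using X h by (simp add: k sup_hom_sup)
    also have "h ` X = k ` A"
      unfolding X(2) image_image using X(1) k by (intro image_cong) auto
    finally show ?thesis .
  qed
  then have "sup_hom Qt M k"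
    using h k by (auto simp: sup_hom_def carrier_quotient)
  with k show ?thesis by blast
qed

end

text \<open>Instantiated twice: with the bimorphism relations on the free sup-lattice, and with the
  balancing relations on the tensor product.\<close>

locale generated_quotient = S: complete_lattice S for S :: "'a gorder" +
  fixes G :: "('a \<times> 'a) set"
  assumes generators: "G \<subseteq> carrier S \<times> carrier S"
begin

sublocale sup_quotient S "generated_congruence S G"
  by unfold_locales (intro sup_congruence_generated S.complete_lattice_axioms generators)

lemma generators_congruent: "(x, y) \<in> G \<Longrightarrow> cls x = cls y"
  by (rule equiv_class_eq[OF equiv]) (auto simp: generated_congruence_def)

lemma extend_hom:
  assumes h: "sup_hom S M h" and resp: "\<And>x y. (x, y) \<in> G \<Longrightarrow> h x = h y"
  shows "\<exists>k. sup_hom Qt M k \<and> (\<forall>x\<in>carrier S. k (cls x) = h x)"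
proof (rule induced_hom[OF h])
  let ?K = "{(x, y). x \<in> carrier S \<and> y \<in> carrier S \<and> h x = h y}"
  fix x y
  assume "(x, y) \<in> generated_congruence S G"
  moreover have "G \<subseteq> ?K"
    using generators resp by auto
  then have "generated_congruence S G \<subseteq> ?K"
    unfolding generated_congruence_def
    using sup_congruence_kernel[OF S.complete_lattice_axioms h] by (intro Inter_lower) simp
  ultimately show "h x = h y"
    by auto
qed

end

section \<open>The universal property of tensor products\<close>

lemma carrier_free: "carrier (free_sup_lattice X) = Pow X"
  by (simp add: free_sup_lattice_def)

lemma le_free: "le (free_sup_lattice X) = (\<subseteq>)"
  by (simp add: free_sup_lattice_def)

lemma partial_order_free: "partial_order (free_sup_lattice X)"
  by unfold_locales (simp_all add: free_sup_lattice_def)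

lemma least_Union_free:
  assumes "\<U> \<subseteq> Pow X"
  shows "least (free_sup_lattice X) (\<Union>\<U>) (Upper (free_sup_lattice X) \<U>)"
proof (rule least_UpperI)
  show "\<Union>\<U> \<sqsubseteq>\<^bsub>free_sup_lattice X\<^esub> V" if "V \<in> Upper (free_sup_lattice X) \<U>" for V
    using that assms by (simp add: le_free carrier_free Upper_def subset_iff) blast
qed (use assms in \<open>auto simp: le_free carrier_free\<close>)

lemma complete_lattice_free: "complete_lattice (free_sup_lattice X)"
proof -
  interpret F: partial_order "free_sup_lattice X" by (rule partial_order_free)
  show ?thesis
    using least_Union_free by (intro F.complete_lattice_if_sups) (auto simp: carrier_free)
qed

lemma sup_free:
  assumes "\<U> \<subseteq> Pow X"
  shows "\<Squnion>\<^bsub>free_sup_lattice X\<^esub> \<U> = \<Union>\<U>"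
proof -
  interpret F: complete_lattice "free_sup_lattice X" by (rule complete_lattice_free)
  show ?thesis
    using least_Union_free[OF assms] assms by (intro F.sup_eq_if_least) (auto simp: carrier_free)
qed

text \<open>The extension of \<open>f\<close> from generators: a set is the union of its singletons,
  which dictates the formula, and a join over a union is a join of joins.\<close>

lemma sup_hom_free:
  assumes "complete_lattice M" and f: "\<And>x. x \<in> X \<Longrightarrow> f x \<in> carrier M"
  shows "sup_hom (free_sup_lattice X) M (\<lambda>U. \<Squnion>\<^bsub>M\<^esub> (f ` U))"
proof -
  interpret M: complete_lattice M by fact
  have "\<Squnion>\<^bsub>M\<^esub> (f ` \<Union>\<U>) = \<Squnion>\<^bsub>M\<^esub> ((\<lambda>U. \<Squnion>\<^bsub>M\<^esub> (f ` U)) ` \<U>)" if "\<U> \<subseteq> Pow X" for \<U>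
    using that f by (subst M.sup_of_sups) (auto simp: image_UN image_Union)
  moreover have "\<Squnion>\<^bsub>M\<^esub> (f ` U) \<in> carrier M" if "U \<subseteq> X" for U
    using that f by (intro M.sup_closed) auto
  ultimately show ?thesis
    by (simp add: sup_hom_def carrier_free sup_free)
qed

locale tensor_product = R: complete_lattice R + L: complete_lattice L
  for R :: "'r gorder" and L :: "'l gorder"
begin

text \<open>The generating pairs of \<open>tensor_congruence\<close>, named so that
  \<open>generated_quotient\<close> can be instantiated with them.\<close>

definition "relations =
  {((\<Union>r\<in>A. {(r, l)}), {(\<Squnion>\<^bsub>R\<^esub> A, l)}) | A l. A \<subseteq> carrier R \<and> l \<in> carrier L} \<union>
  {((\<Union>l\<in>B. {(r, l)}), {(r, \<Squnion>\<^bsub>L\<^esub> B)}) | r B. r \<in> carrier R \<and> B \<subseteq> carrier L}"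

lemma relations_closed:
  "relations \<subseteq> carrier (free_sup_lattice (carrier R \<times> carrier L)) \<times>
     carrier (free_sup_lattice (carrier R \<times> carrier L))"
  by (auto simp: relations_def carrier_free)

sublocale F: generated_quotient "free_sup_lattice (carrier R \<times> carrier L)" relations
  by (intro generated_quotient.intro complete_lattice_free generated_quotient_axioms.intro
      relations_closed)

lemma tensor_congruence_eq:
  "tensor_congruence R L =
    generated_congruence (free_sup_lattice (carrier R \<times> carrier L)) relations"
  by (simp add: tensor_congruence_def relations_def)

lemma tensor_eq: "tensor R L = F.Qt"
  by (simp add: tensor_def tensor_congruence_eq)

lemma pure_tensor_eq: "pure_tensor R L r l = F.cls {(r, l)}"
  by (simp add: pure_tensor_def tensor_congruence_eq)

lemma complete_lattice_tensor: "complete_lattice (tensor R L)"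
  unfolding tensor_eq by (rule F.complete_lattice_quotient)

text \<open>\<open>U\<close> is the join of its singletons in the free sup-lattice, and the
  projection preserves joins.\<close>

lemma cls_eq_sup_pure:
  assumes "U \<subseteq> carrier R \<times> carrier L"
  shows "F.cls U = \<Squnion>\<^bsub>tensor R L\<^esub> ((\<lambda>(r, l). pure_tensor R L r l) ` U)"
proof -
  let ?F = "free_sup_lattice (carrier R \<times> carrier L)"
  have sub: "(\<lambda>u. {u}) ` U \<subseteq> carrier ?F"
    using assms by (auto simp: carrier_free)
  then have "\<Squnion>\<^bsub>?F\<^esub> ((\<lambda>u. {u}) ` U) = U"
    by (subst sup_free) (auto simp: carrier_free)
  moreover have "F.cls (\<Squnion>\<^bsub>?F\<^esub> ((\<lambda>u. {u}) ` U)) = \<Squnion>\<^bsub>F.Qt\<^esub> (F.cls ` (\<lambda>u. {u}) ` U)"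
    by (rule sup_hom_sup[OF F.sup_hom_cls sub])
  ultimately show ?thesis
    by (simp add: image_image tensor_eq pure_tensor_eq case_prod_unfold)
qed

lemma pure_tensor_closed:
  "\<lbrakk>r \<in> carrier R; l \<in> carrier L\<rbrakk> \<Longrightarrow> pure_tensor R L r l \<in> carrier (tensor R L)"
  by (auto simp: tensor_eq pure_tensor_eq F.carrier_quotient carrier_free)

text \<open>A generating relation identifies the class of a set of pairs with one pure tensor;
  \<open>cls_eq_sup_pure\<close> reads the same class as a join of pure tensors.\<close>

lemma bimorphism_pure_tensor: "bimorphism R L (tensor R L) (pure_tensor R L)"
proof -
  have "pure_tensor R L (\<Squnion>\<^bsub>R\<^esub> A) l = \<Squnion>\<^bsub>tensor R L\<^esub> ((\<lambda>r. pure_tensor R L r l) ` A)"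
    if "A \<subseteq> carrier R" "l \<in> carrier L" for A l
  proof -
    have "F.cls (\<Union>r\<in>A. {(r, l)}) = F.cls {(\<Squnion>\<^bsub>R\<^esub> A, l)}"
      using that by (intro F.generators_congruent) (auto simp: relations_def)
    moreover have "F.cls (\<Union>r\<in>A. {(r, l)}) =
        \<Squnion>\<^bsub>tensor R L\<^esub> ((\<lambda>(r, l). pure_tensor R L r l) ` (\<Union>r\<in>A. {(r, l)}))"
      using that by (intro cls_eq_sup_pure) auto
    moreover have "(\<lambda>(r, l). pure_tensor R L r l) ` (\<Union>r\<in>A. {(r, l)}) =
        (\<lambda>r. pure_tensor R L r l) ` A"
      by auto
    ultimately show ?thesis
      by (simp add: pure_tensor_eq)
  qed
  moreover have "pure_tensor R L r (\<Squnion>\<^bsub>L\<^esub> B) = \<Squnion>\<^bsub>tensor R L\<^esub> (pure_tensor R L r ` B)"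
    if "r \<in> carrier R" "B \<subseteq> carrier L" for r B
  proof -
    have "F.cls (\<Union>l\<in>B. {(r, l)}) = F.cls {(r, \<Squnion>\<^bsub>L\<^esub> B)}"
      using that by (intro F.generators_congruent) (auto simp: relations_def)
    moreover have "F.cls (\<Union>l\<in>B. {(r, l)}) =
        \<Squnion>\<^bsub>tensor R L\<^esub> ((\<lambda>(r, l). pure_tensor R L r l) ` (\<Union>l\<in>B. {(r, l)}))"
      using that by (intro cls_eq_sup_pure) auto
    moreover have "(\<lambda>(r, l). pure_tensor R L r l) ` (\<Union>l\<in>B. {(r, l)}) =
        pure_tensor R L r ` B"
      by auto
    ultimately show ?thesis
      by (simp add: pure_tensor_eq)
  qed
  ultimately show ?thesis
    by (simp add: bimorphism_def pure_tensor_closed)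
qed

lemma tensor_join_of_pure:
  assumes "q \<in> carrier (tensor R L)"
  obtains U where "U \<subseteq> carrier R \<times> carrier L"
    "q = \<Squnion>\<^bsub>tensor R L\<^esub> ((\<lambda>(r, l). pure_tensor R L r l) ` U)"
  using assms cls_eq_sup_pure unfolding tensor_eq F.carrier_quotient by (auto simp: carrier_free)

text \<open>The extension \<open>?h\<close> of \<open>f\<close> to the free sup-lattice sends the
  two sides of a relation to a join of values of \<open>f\<close> and to the value of
  \<open>f\<close> at a join; these agree because \<open>f\<close> is a bimorphism.\<close>

lemma tensor_extend_bimorphism:
  assumes "complete_lattice M" and f: "bimorphism R L M f"
  shows "\<exists>k. sup_hom (tensor R L) M k \<and>
    (\<forall>r\<in>carrier R. \<forall>l\<in>carrier L. k (pure_tensor R L r l) = f r l)"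
proof -
  interpret M: complete_lattice M by fact
  let ?h = "\<lambda>U. \<Squnion>\<^bsub>M\<^esub> ((\<lambda>(r, l). f r l) ` U)"
  have single: "?h {(r, l)} = f r l" if "r \<in> carrier R" "l \<in> carrier L" for r l
    using that f by (simp add: M.sup_singleton bimorphism_closed)
  have "\<exists>k. sup_hom F.Qt M k \<and>
      (\<forall>U\<in>carrier (free_sup_lattice (carrier R \<times> carrier L)). k (F.cls U) = ?h U)"
  proof (rule F.extend_hom)
    show "sup_hom (free_sup_lattice (carrier R \<times> carrier L)) M ?h"
      using f by (intro sup_hom_free M.complete_lattice_axioms) (auto simp: bimorphism_closed)
  next
    fix U V
    assume "(U, V) \<in> relations"
    then consider
      (left) A l where "A \<subseteq> carrier R" "l \<in> carrier L"
        "U = (\<Union>r\<in>A. {(r, l)})" "V = {(\<Squnion>\<^bsub>R\<^esub> A, l)}"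
    | (right) r B where "r \<in> carrier R" "B \<subseteq> carrier L"
        "U = (\<Union>l\<in>B. {(r, l)})" "V = {(r, \<Squnion>\<^bsub>L\<^esub> B)}"
      unfolding relations_def by blast
    then show "?h U = ?h V"
    proof cases
      case left
      have "(\<lambda>(r, l). f r l) ` U = (\<lambda>r. f r l) ` A"
        using left by auto
      then show ?thesis
        using left f single[of "\<Squnion>\<^bsub>R\<^esub> A" l] by (simp only: bimorphism_def R.sup_closed)
    next
      case right
      have "(\<lambda>(r, l). f r l) ` U = f r ` B"
        using right by auto
      then show ?thesis
        using right f single[of r "\<Squnion>\<^bsub>L\<^esub> B"] by (simp only: bimorphism_def L.sup_closed)
    qed
  qed
  then obtain k where "sup_hom F.Qt M k"
    and "\<And>U. U \<subseteq> carrier R \<times> carrier L \<Longrightarrow> k (F.cls U) = ?h U"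
    by (auto simp: carrier_free)
  then show ?thesis
    using single by (intro exI[of _ k]) (simp add: tensor_eq pure_tensor_eq)
qed

end

section \<open>The tensor product over \<open>T\<close> and its universal property\<close>

context quantum_triad
begin

abbreviation "Q0 \<equiv> balanced_tensor R T L RT TL"
abbreviation "pure \<equiv> balanced_pure R T L RT TL"

sublocale tensor: tensor_product R L ..

definition "balancing =
  {(pure_tensor R L (RT r t) l, pure_tensor R L r (TL t l)) | r t l.
     r \<in> carrier R \<and> t \<in> carrier T \<and> l \<in> carrier L}"

lemmas RT_closed = bimorphism_closed[OF R.right_action_bimorphism]
lemmas TL_closed = bimorphism_closed[OF L.left_action_bimorphism]
lemmas LR_closed = bimorphism_closed[OF LR_bimorphism]

lemma balancing_closed: "balancing \<subseteq> carrier (tensor R L) \<times> carrier (tensor R L)"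
  unfolding balancing_def
  by (auto intro!: tensor.pure_tensor_closed intro: RT_closed TL_closed)

sublocale B: generated_quotient "tensor R L" balancing
  by (intro generated_quotient.intro tensor.complete_lattice_tensor
      generated_quotient_axioms.intro balancing_closed)

lemma balanced_congruence_eq:
  "balanced_congruence R T L RT TL = generated_congruence (tensor R L) balancing"
  by (simp add: balanced_congruence_def balancing_def)

lemma Q0_eq: "Q0 = B.Qt"
  by (simp add: balanced_tensor_def balanced_congruence_eq)

lemma pure_eq: "pure r l = B.cls (pure_tensor R L r l)"
  by (simp add: balanced_pure_def balanced_congruence_eq)

lemma complete_lattice_Q0: "complete_lattice Q0"
  unfolding Q0_eq by (rule B.complete_lattice_quotient)

lemma pure_bimorphism: "bimorphism R L Q0 pure"
  unfolding Q0_eq pure_eq[abs_def]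
proof (rule bimorphismI)
  show "sup_hom R B.Qt (\<lambda>r. B.cls (pure_tensor R L r l))" if "l \<in> carrier L" for l
    by (rule sup_hom_comp[OF bimorphism_hom_left[OF tensor.bimorphism_pure_tensor that]
          B.sup_hom_cls])
  show "sup_hom L B.Qt (\<lambda>l. B.cls (pure_tensor R L r l))" if "r \<in> carrier R" for r
    by (rule sup_hom_comp[OF bimorphism_hom_right[OF tensor.bimorphism_pure_tensor that]
          B.sup_hom_cls])
qed

lemmas pure_closed = bimorphism_closed[OF pure_bimorphism]

lemma pure_balanced:
  "\<lbrakk>r \<in> carrier R; t \<in> carrier T; l \<in> carrier L\<rbrakk> \<Longrightarrow> pure (RT r t) l = pure r (TL t l)"
  unfolding pure_eq by (intro B.generators_congruent) (auto simp: balancing_def)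

lemma Q0_join_of_pure:
  assumes "q \<in> carrier Q0"
  obtains U where "U \<subseteq> carrier R \<times> carrier L"
    "q = \<Squnion>\<^bsub>Q0\<^esub> ((\<lambda>(r, l). pure r l) ` U)"
proof -
  obtain x where x: "x \<in> carrier (tensor R L)" "q = B.cls x"
    using assms unfolding Q0_eq B.carrier_quotient by auto
  obtain U where U: "U \<subseteq> carrier R \<times> carrier L"
    "x = \<Squnion>\<^bsub>tensor R L\<^esub> ((\<lambda>(r, l). pure_tensor R L r l) ` U)"
    using tensor.tensor_join_of_pure[OF x(1)] by blast
  have "(\<lambda>(r, l). pure_tensor R L r l) ` U \<subseteq> carrier (tensor R L)"
    using U(1) by (auto intro: tensor.pure_tensor_closed)
  from sup_hom_sup[OF B.sup_hom_cls this] have "q = \<Squnion>\<^bsub>Q0\<^esub> ((\<lambda>(r, l). pure r l) ` U)"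
    by (simp add: x(2) U(2) Q0_eq pure_eq image_image case_prod_unfold)
  with U(1) show thesis by (rule that)
qed

lemma Q0_hom_eqI:
  assumes h: "sup_hom Q0 M h" and k: "sup_hom Q0 M k"
    and eq: "\<And>r l. \<lbrakk>r \<in> carrier R; l \<in> carrier L\<rbrakk> \<Longrightarrow> h (pure r l) = k (pure r l)"
    and q: "q \<in> carrier Q0"
  shows "h q = k q"
proof -
  obtain U where U: "U \<subseteq> carrier R \<times> carrier L" "q = \<Squnion>\<^bsub>Q0\<^esub> ((\<lambda>(r, l). pure r l) ` U)"
    using Q0_join_of_pure[OF q] by blast
  have sub: "(\<lambda>(r, l). pure r l) ` U \<subseteq> carrier Q0"
    using U(1) by (auto intro: pure_closed)
  have "h ` (\<lambda>(r, l). pure r l) ` U = k ` (\<lambda>(r, l). pure r l) ` U"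
    unfolding image_image using U(1) eq by (intro image_cong) auto
  then show ?thesis
    unfolding U(2) by (simp add: sup_hom_sup[OF h sub] sup_hom_sup[OF k sub])
qed

lemma Q0_extend_bimorphism:
  assumes "complete_lattice M" and f: "bimorphism R L M f"
    and balanced: "\<And>r t l. \<lbrakk>r \<in> carrier R; t \<in> carrier T; l \<in> carrier L\<rbrakk>
      \<Longrightarrow> f (RT r t) l = f r (TL t l)"
  shows "\<exists>k. sup_hom Q0 M k \<and> (\<forall>r\<in>carrier R. \<forall>l\<in>carrier L. k (pure r l) = f r l)"
proof -
  obtain h where h: "sup_hom (tensor R L) M h"
    and h_pure: "\<And>r l. \<lbrakk>r \<in> carrier R; l \<in> carrier L\<rbrakk> \<Longrightarrow> h (pure_tensor R L r l) = f r l"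
    using tensor.tensor_extend_bimorphism[OF assms(1,2)] by blast
  have "h x = h y" if "(x, y) \<in> balancing" for x y
    using that balanced by (auto simp: balancing_def h_pure RT_closed TL_closed)
  from B.extend_hom[OF h this] obtain k where "sup_hom B.Qt M k"
    and "\<And>x. x \<in> carrier (tensor R L) \<Longrightarrow> k (B.cls x) = h x"
    by blast
  then show ?thesis
    by (intro exI[of _ k]) (simp add: Q0_eq pure_eq h_pure tensor.pure_tensor_closed)
qed

text \<open>The form used to build binary operations: \<open>n\<close> is the argument that is not
  reduced to pure tensors. It is applied with \<open>N\<close> equal to \<open>R\<close>,
  \<open>L\<close> and \<open>Q0\<close>.\<close>

lemma Q0_extend_trimorphism:
  assumes "complete_lattice N" "complete_lattice M"
    and RL: "\<And>n. n \<in> carrier N \<Longrightarrow> bimorphism R L M (\<lambda>r l. f r l n)"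
    and N: "\<And>r l. \<lbrakk>r \<in> carrier R; l \<in> carrier L\<rbrakk> \<Longrightarrow> sup_hom N M (f r l)"
    and balanced: "\<And>r t l n. \<lbrakk>r \<in> carrier R; t \<in> carrier T; l \<in> carrier L; n \<in> carrier N\<rbrakk>
      \<Longrightarrow> f (RT r t) l n = f r (TL t l) n"
  shows "\<exists>F. bimorphism Q0 N M F \<and>
    (\<forall>r\<in>carrier R. \<forall>l\<in>carrier L. \<forall>n\<in>carrier N. F (pure r l) n = f r l n)"
proof -
  interpret N: complete_lattice N by fact
  have "\<forall>n\<in>carrier N. \<exists>k. sup_hom Q0 M k \<and>
      (\<forall>r\<in>carrier R. \<forall>l\<in>carrier L. k (pure r l) = f r l n)"
    using assms by (intro ballI Q0_extend_bimorphism) auto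
  then obtain H where H: "\<And>n. n \<in> carrier N \<Longrightarrow> sup_hom Q0 M (H n)"
    and H_pure: "\<And>n r l. \<lbrakk>n \<in> carrier N; r \<in> carrier R; l \<in> carrier L\<rbrakk>
      \<Longrightarrow> H n (pure r l) = f r l n"
    by metis
  \<comment> \<open>Each \<open>H n\<close> was chosen separately. Both sides preserve joins in
    \<open>q\<close>, and on pure tensors they agree because \<open>f r l\<close> preserves joins in
    \<open>n\<close>.\<close>
  have "H (\<Squnion>\<^bsub>N\<^esub> X) q = \<Squnion>\<^bsub>M\<^esub> ((\<lambda>n. H n q) ` X)"
    if X: "X \<subseteq> carrier N" and q: "q \<in> carrier Q0" for X q
  proof (rule Q0_hom_eqI[OF _ _ _ q])
    show "sup_hom Q0 M (H (\<Squnion>\<^bsub>N\<^esub> X))"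
      using X by (simp add: H)
    show "sup_hom Q0 M (\<lambda>q. \<Squnion>\<^bsub>M\<^esub> ((\<lambda>n. H n q) ` X))"
      using X by (intro sup_hom_pointwise_sup assms H) auto
    fix r l
    assume rl: "r \<in> carrier R" "l \<in> carrier L"
    have "(\<lambda>n. H n (pure r l)) ` X = f r l ` X"
      using X rl by (intro image_cong) (auto simp: H_pure)
    then show "H (\<Squnion>\<^bsub>N\<^esub> X) (pure r l) = \<Squnion>\<^bsub>M\<^esub> ((\<lambda>n. H n (pure r l)) ` X)"
      using X rl sup_hom_sup[OF N X] by (simp add: H_pure)
  qed
  then have "bimorphism Q0 N M (\<lambda>q n. H n q)"
    using H by (intro bimorphismI) (auto simp: sup_hom_def)
  then show ?thesis
    using H_pure by blast
qed

section \<open>The operations on \<open>R \<otimes>\<^sub>T L\<close>\<close>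

lemmas RT_hom_left = bimorphism_hom_left[OF R.right_action_bimorphism]
lemmas RT_hom_right = bimorphism_hom_right[OF R.right_action_bimorphism]
lemmas TL_hom_left = bimorphism_hom_left[OF L.left_action_bimorphism]
lemmas TL_hom_right = bimorphism_hom_right[OF L.left_action_bimorphism]
lemmas LR_hom_left = bimorphism_hom_left[OF LR_bimorphism]
lemmas LR_hom_right = bimorphism_hom_right[OF LR_bimorphism]
lemmas pure_hom_left = bimorphism_hom_left[OF pure_bimorphism]
lemmas pure_hom_right = bimorphism_hom_right[OF pure_bimorphism]

text \<open>The prescribed value is balanced:
  \<open>(r t)(l r') = r (t (l r')) = r ((t l) r')\<close>.\<close>

lemma left_action_exists:
  "\<exists>QR. bimorphism Q0 R R QR \<and>
    (\<forall>r\<in>carrier R. \<forall>l\<in>carrier L. \<forall>r'\<in>carrier R. QR (pure r l) r' = RT r (LR l r'))"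
proof (rule Q0_extend_trimorphism[OF R.M.complete_lattice_axioms R.M.complete_lattice_axioms])
  show "bimorphism R L R (\<lambda>r l. RT r (LR l r'))" if "r' \<in> carrier R" for r'
    using that
    by (auto intro!: bimorphismI RT_hom_left LR_closed sup_hom_comp[OF LR_hom_left RT_hom_right])
  show "sup_hom R R (\<lambda>r'. RT r (LR l r'))" if "r \<in> carrier R" "l \<in> carrier L" for r l
    using that by (intro sup_hom_comp[OF LR_hom_right RT_hom_right])
  show "RT (RT r t) (LR l r') = RT r (LR (TL t l) r')"
    if "r \<in> carrier R" "t \<in> carrier T" "l \<in> carrier L" "r' \<in> carrier R" for r t l r'
    using that by (simp add: TL_LR R.right_action_assoc LR_closed)
qed

text \<open>Balancing reads \<open>(l (r t)) l' = ((l r) t) l' = (l r)(t l')\<close>. The extension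
  lemma puts \<open>Q0\<close> in the first argument, so the action is built with its arguments
  exchanged and then flipped.\<close>

lemma right_action_exists:
  "\<exists>LQ. bimorphism L Q0 L LQ \<and>
    (\<forall>l\<in>carrier L. \<forall>r\<in>carrier R. \<forall>l'\<in>carrier L. LQ l (pure r l') = TL (LR l r) l')"
proof -
  have "\<exists>F. bimorphism Q0 L L F \<and>
    (\<forall>r\<in>carrier R. \<forall>l'\<in>carrier L. \<forall>l\<in>carrier L. F (pure r l') l = TL (LR l r) l')"
  proof (rule Q0_extend_trimorphism[OF L.M.complete_lattice_axioms L.M.complete_lattice_axioms])
    show "bimorphism R L L (\<lambda>r l'. TL (LR l r) l')" if "l \<in> carrier L" for l
      using that
      by (auto intro!: bimorphismI TL_hom_right LR_closed sup_hom_comp[OF LR_hom_right TL_hom_left])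
    show "sup_hom L L (\<lambda>l. TL (LR l r) l')" if "r \<in> carrier R" "l' \<in> carrier L" for r l'
      using that by (intro sup_hom_comp[OF LR_hom_left TL_hom_left])
    show "TL (LR l (RT r t)) l' = TL (LR l r) (TL t l')"
      if "r \<in> carrier R" "t \<in> carrier T" "l' \<in> carrier L" "l \<in> carrier L" for r t l' l
      using that by (simp add: LR_RT[symmetric] L.left_action_assoc LR_closed)
  qed
  then obtain F where "bimorphism Q0 L L F"
    and "\<forall>r\<in>carrier R. \<forall>l'\<in>carrier L. \<forall>l\<in>carrier L. F (pure r l') l = TL (LR l r) l'"
    by blast
  then show ?thesis
    by (intro exI[of _ "\<lambda>l q. F q l"]) (simp add: bimorphism_flip[of L])
qed

text \<open>Stated for any \<open>LQ\<close> with the prescribed values because it serves twice: in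
  constructing the product, where it makes \<open>r \<otimes> (l q)\<close> balanced, and later as a
  bimodule axiom.\<close>

lemma TL_right_action:
  assumes LQ: "bimorphism L Q0 L LQ"
    and LQ_pure: "\<And>l r l'. \<lbrakk>l \<in> carrier L; r \<in> carrier R; l' \<in> carrier L\<rbrakk>
      \<Longrightarrow> LQ l (pure r l') = TL (LR l r) l'"
    and t: "t \<in> carrier T" and l: "l \<in> carrier L" and q: "q \<in> carrier Q0"
  shows "LQ (TL t l) q = TL t (LQ l q)"
proof (rule Q0_hom_eqI[OF _ _ _ q])
  show "sup_hom Q0 L (LQ (TL t l))"
    using t l by (intro bimorphism_hom_right[OF LQ] TL_closed)
  show "sup_hom Q0 L (\<lambda>q. TL t (LQ l q))"
    using t l by (intro sup_hom_comp[OF bimorphism_hom_right[OF LQ] TL_hom_right])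
  show "LQ (TL t l) (pure r l') = TL t (LQ l (pure r l'))"
    if "r \<in> carrier R" "l' \<in> carrier L" for r l'
    using that t l by (simp add: LQ_pure TL_closed TL_LR L.left_action_assoc LR_closed)
qed

text \<open>The product is obtained from the right action on \<open>L\<close> as \<open>(r \<otimes> l) q = r \<otimes> (l q)\<close>, so that
  only one of its arguments has to be extended from pure tensors.\<close>

lemma operations_exist: "\<exists>QQ QR LQ. Q0_operations L T R TL RT LR QQ QR LQ"
proof -
  obtain QR where QR: "bimorphism Q0 R R QR"
    "\<forall>r\<in>carrier R. \<forall>l\<in>carrier L. \<forall>r'\<in>carrier R. QR (pure r l) r' = RT r (LR l r')"
    using left_action_exists by blast
  obtain LQ where LQ: "bimorphism L Q0 L LQ"
    and LQ_pure: "\<forall>l\<in>carrier L. \<forall>r\<in>carrier R. \<forall>l'\<in>carrier L. LQ l (pure r l') = TL (LR l r) l'"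
    using right_action_exists by blast
  note LQ_closed = bimorphism_closed[OF LQ]
  have "\<exists>QQ. bimorphism Q0 Q0 Q0 QQ \<and>
    (\<forall>r\<in>carrier R. \<forall>l\<in>carrier L. \<forall>q\<in>carrier Q0. QQ (pure r l) q = pure r (LQ l q))"
  proof (rule Q0_extend_trimorphism[OF complete_lattice_Q0 complete_lattice_Q0])
    show "bimorphism R L Q0 (\<lambda>r l. pure r (LQ l q))" if "q \<in> carrier Q0" for q
      using that
      by (auto intro!: bimorphismI pure_hom_left LQ_closed
          sup_hom_comp[OF bimorphism_hom_left[OF LQ] pure_hom_right])
    show "sup_hom Q0 Q0 (\<lambda>q. pure r (LQ l q))" if "r \<in> carrier R" "l \<in> carrier L" for r l
      using that by (intro sup_hom_comp[OF bimorphism_hom_right[OF LQ] pure_hom_right])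
    show "pure (RT r t) (LQ l q) = pure r (LQ (TL t l) q)"
      if "r \<in> carrier R" "t \<in> carrier T" "l \<in> carrier L" "q \<in> carrier Q0" for r t l q
      using that LQ_pure by (simp add: TL_right_action[OF LQ] pure_balanced LQ_closed)
  qed
  then obtain QQ where QQ: "bimorphism Q0 Q0 Q0 QQ"
    and "\<forall>r\<in>carrier R. \<forall>l\<in>carrier L. \<forall>q\<in>carrier Q0. QQ (pure r l) q = pure r (LQ l q)"
    by blast
  \<comment> \<open>Balancing moves the scalar \<open>l r'\<close> across the tensor:
    \<open>r \<otimes> (l r') l' = r (l r') \<otimes> l'\<close>.\<close>
  then have "QQ (pure r l) (pure r' l') = pure (RT r (LR l r')) l'"
    if "r \<in> carrier R" "l \<in> carrier L" "r' \<in> carrier R" "l' \<in> carrier L" for r l r' l'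
    using that LQ_pure by (simp add: pure_closed pure_balanced LR_closed)
  with QR LQ LQ_pure QQ show ?thesis
    unfolding Q0_operations_def Let_def by blast
qed

end

section \<open>Solution axioms and uniqueness for arbitrary operations meeting the
  specification\<close>

locale triad_operations = quantum_triad L T R TT TL RT LR
  for L :: "'l gorder" and T :: "'t gorder" and R :: "'r gorder"
    and TT :: "'t \<Rightarrow> 't \<Rightarrow> 't" and TL :: "'t \<Rightarrow> 'l \<Rightarrow> 'l" and RT :: "'r \<Rightarrow> 't \<Rightarrow> 'r"
    and LR :: "'l \<Rightarrow> 'r \<Rightarrow> 't" +
  fixes QQ QR LQ
  assumes operations: "Q0_operations L T R TL RT LR QQ QR LQ"
begin

lemma QR_bimorphism: "bimorphism Q0 R R QR"
  and LQ_bimorphism: "bimorphism L Q0 L LQ"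
  and QQ_bimorphism: "bimorphism Q0 Q0 Q0 QQ"
  using operations by (simp_all add: Q0_operations_def Let_def)

lemma QR_pure: "\<lbrakk>r \<in> carrier R; l \<in> carrier L; r' \<in> carrier R\<rbrakk>
    \<Longrightarrow> QR (pure r l) r' = RT r (LR l r')"
  and LQ_pure: "\<lbrakk>l \<in> carrier L; r \<in> carrier R; l' \<in> carrier L\<rbrakk>
    \<Longrightarrow> LQ l (pure r l') = TL (LR l r) l'"
  and QQ_pure: "\<lbrakk>r \<in> carrier R; l \<in> carrier L; r' \<in> carrier R; l' \<in> carrier L\<rbrakk>
    \<Longrightarrow> QQ (pure r l) (pure r' l') = pure (RT r (LR l r')) l'"
  using operations by (simp_all add: Q0_operations_def Let_def)

lemmas QR_closed = bimorphism_closed[OF QR_bimorphism]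
lemmas LQ_closed = bimorphism_closed[OF LQ_bimorphism]
lemmas QQ_closed = bimorphism_closed[OF QQ_bimorphism]
lemmas closed = QR_closed LQ_closed QQ_closed RT_closed TL_closed LR_closed pure_closed

lemmas QR_hom_left = bimorphism_hom_left[OF QR_bimorphism]
lemmas LQ_hom_left = bimorphism_hom_left[OF LQ_bimorphism]
lemmas LQ_hom_right = bimorphism_hom_right[OF LQ_bimorphism]
lemmas QQ_hom_left = bimorphism_hom_left[OF QQ_bimorphism]
lemmas QQ_hom_right = bimorphism_hom_right[OF QQ_bimorphism]

lemma QR_RT:
  assumes "q \<in> carrier Q0" "r \<in> carrier R" "t \<in> carrier T"
  shows "RT (QR q r) t = QR q (RT r t)"
  by (rule Q0_hom_eqI[OF sup_hom_comp[OF QR_hom_left RT_hom_left] QR_hom_left _ assms(1)])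
    (use assms in \<open>simp_all add: closed QR_pure LR_RT[symmetric] R.right_action_assoc\<close>)

lemma TL_LQ: "\<lbrakk>t \<in> carrier T; l \<in> carrier L; q \<in> carrier Q0\<rbrakk> \<Longrightarrow> LQ (TL t l) q = TL t (LQ l q)"
  by (rule TL_right_action[OF LQ_bimorphism LQ_pure])

lemma pure_QR:
  assumes "q \<in> carrier Q0" "r \<in> carrier R" "l \<in> carrier L"
  shows "pure (QR q r) l = QQ q (pure r l)"
  by (rule Q0_hom_eqI[OF sup_hom_comp[OF QR_hom_left pure_hom_left] QQ_hom_left _ assms(1)])
    (use assms in \<open>simp_all add: closed QR_pure QQ_pure\<close>)

text \<open>Recovers, for any admissible product, the formula by which the product was constructed.
  Products with a pure left factor thereby reduce to the right action on \<open>L\<close>, with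
  \<open>q\<close> left arbitrary.\<close>

lemma pure_LQ:
  assumes "q \<in> carrier Q0" "r \<in> carrier R" "l \<in> carrier L"
  shows "QQ (pure r l) q = pure r (LQ l q)"
  by (rule Q0_hom_eqI[OF QQ_hom_right sup_hom_comp[OF LQ_hom_right pure_hom_right] _ assms(1)])
    (use assms in \<open>simp_all add: closed LQ_pure QQ_pure pure_balanced\<close>)

text \<open>For \<open>q = r' \<otimes> l'\<close> both sides equal \<open>(l r')(l' r)\<close>, by
  the two compatibility axioms of the triad.\<close>

lemma LQ_QR:
  assumes "l \<in> carrier L" "q \<in> carrier Q0" "r \<in> carrier R"
  shows "LR (LQ l q) r = LR l (QR q r)"
  by (rule Q0_hom_eqI[OF sup_hom_comp[OF LQ_hom_right LR_hom_left]
        sup_hom_comp[OF QR_hom_left LR_hom_right] _ assms(2)])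
    (use assms in \<open>simp_all add: closed LQ_pure QR_pure TL_LR LR_RT\<close>)

text \<open>Only \<open>p = r' \<otimes> l\<close> is reduced:
  \<open>(r' \<otimes> l q) r = r' ((l q) r) = r' (l (q r))\<close>.\<close>

lemma QR_assoc:
  assumes "p \<in> carrier Q0" "q \<in> carrier Q0" "r \<in> carrier R"
  shows "QR (QQ p q) r = QR p (QR q r)"
  by (rule Q0_hom_eqI[OF sup_hom_comp[OF QQ_hom_left QR_hom_left] QR_hom_left _ assms(1)])
    (use assms in \<open>simp_all add: closed pure_LQ QR_pure LQ_QR\<close>)

text \<open>For \<open>p = r \<otimes> l'\<close> the left side is
  \<open>l (r \<otimes> l' q) = (l r)(l' q)\<close>, and \<open>TL_LQ\<close> turns this into
  \<open>((l r) l') q\<close>.\<close>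

lemma LQ_assoc:
  assumes "l \<in> carrier L" "p \<in> carrier Q0" "q \<in> carrier Q0"
  shows "LQ l (QQ p q) = LQ (LQ l p) q"
  by (rule Q0_hom_eqI[OF sup_hom_comp[OF QQ_hom_left LQ_hom_right]
        sup_hom_comp[OF LQ_hom_right LQ_hom_left] _ assms(2)])
    (use assms in \<open>simp_all add: closed pure_LQ LQ_pure TL_LQ\<close>)

text \<open>For \<open>p = r \<otimes> l\<close> the two sides become
  \<open>r \<otimes> ((l q) s)\<close> and \<open>r \<otimes> (l (q s))\<close>, so associativity is
  inherited from the right action on \<open>L\<close>.\<close>

lemma QQ_assoc:
  assumes "p \<in> carrier Q0" "q \<in> carrier Q0" "s \<in> carrier Q0"
  shows "QQ (QQ p q) s = QQ p (QQ q s)"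
  by (rule Q0_hom_eqI[OF sup_hom_comp[OF QQ_hom_left QQ_hom_left] QQ_hom_left _ assms(1)])
    (use assms in \<open>simp_all add: closed pure_LQ LQ_assoc\<close>)

text \<open>The axioms \<open>RL_LR\<close> and \<open>LR_RL\<close> are the prescribed values of
  the two actions on pure tensors, and \<open>RT_TL\<close> is the balancing relation; the others
  are the laws above.\<close>

lemma solution: "triad_solution L T R TT TL RT LR Q0 QQ QR LQ pure"
proof -
  interpret Q0: complete_lattice Q0 by (rule complete_lattice_Q0)
  show ?thesis
    by unfold_locales
      (simp_all add: QR_bimorphism LQ_bimorphism QQ_bimorphism pure_bimorphism QQ_assoc QR_assoc
        LQ_assoc QR_RT TL_LQ pure_QR pure_LQ pure_balanced LQ_QR QR_pure LQ_pure)
qed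

lemma operations_unique:
  assumes "Q0_operations L T R TL RT LR QQ' QR' LQ'"
  shows "\<lbrakk>p \<in> carrier Q0; q \<in> carrier Q0\<rbrakk> \<Longrightarrow> QQ p q = QQ' p q"
    and "\<lbrakk>q \<in> carrier Q0; r \<in> carrier R\<rbrakk> \<Longrightarrow> QR q r = QR' q r"
    and "\<lbrakk>l \<in> carrier L; q \<in> carrier Q0\<rbrakk> \<Longrightarrow> LQ l q = LQ' l q"
proof -
  interpret other: triad_operations L T R TT TL RT LR QQ' QR' LQ'
    by unfold_locales fact
  show QR: "QR q r = QR' q r" if "q \<in> carrier Q0" "r \<in> carrier R" for q r
    by (rule Q0_hom_eqI[OF QR_hom_left other.QR_hom_left _ that(1)])
      (use that in \<open>simp_all add: QR_pure other.QR_pure\<close>)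
  show LQ: "LQ l q = LQ' l q" if "l \<in> carrier L" "q \<in> carrier Q0" for l q
    by (rule Q0_hom_eqI[OF LQ_hom_right other.LQ_hom_right _ that(2)])
      (use that in \<open>simp_all add: LQ_pure other.LQ_pure\<close>)
  \<comment> \<open>With \<open>p = r \<otimes> l\<close> both products are
    \<open>r \<otimes> (l q)\<close> for their own right action, so uniqueness of that action
    suffices.\<close>
  show "QQ p q = QQ' p q" if "p \<in> carrier Q0" "q \<in> carrier Q0" for p q
    by (rule Q0_hom_eqI[OF QQ_hom_left other.QQ_hom_left _ that(1)])
      (use that in \<open>simp_all add: pure_LQ other.pure_LQ LQ\<close>)
qed

end

text \<open>Since \<open>Q0_operations\<close> is a predicate, existence keeps the last conjunct
  from being vacuous, and existence with uniqueness justifies speaking of the operations determined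
  on pure tensors. Uniqueness is claimed on carriers, as the total functions of the logic are
  unconstrained elsewhere.\<close>

theorem lemma3p4:
  fixes L :: "'l gorder" and T :: "'t gorder" and R :: "'r gorder"
    and TT :: "'t \<Rightarrow> 't \<Rightarrow> 't" and TL :: "'t \<Rightarrow> 'l \<Rightarrow> 'l" and RT :: "'r \<Rightarrow> 't \<Rightarrow> 'r"
    and LR :: "'l \<Rightarrow> 'r \<Rightarrow> 't"
  assumes "quantum_triad L T R TT TL RT LR"
  shows "(\<exists>QQ QR LQ. Q0_operations L T R TL RT LR QQ QR LQ) \<and>
    (\<forall>QQ QR LQ QQ' QR' LQ'.
       Q0_operations L T R TL RT LR QQ QR LQ \<and> Q0_operations L T R TL RT LR QQ' QR' LQ' \<longrightarrow>
       (\<forall>p\<in>carrier (balanced_tensor R T L RT TL). \<forall>q\<in>carrier (balanced_tensor R T L RT TL).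
          QQ p q = QQ' p q) \<and>
       (\<forall>q\<in>carrier (balanced_tensor R T L RT TL). \<forall>r\<in>carrier R. QR q r = QR' q r) \<and>
       (\<forall>l\<in>carrier L. \<forall>q\<in>carrier (balanced_tensor R T L RT TL). LQ l q = LQ' l q)) \<and>
    (\<forall>QQ QR LQ. Q0_operations L T R TL RT LR QQ QR LQ \<longrightarrow>
       triad_solution L T R TT TL RT LR
         (balanced_tensor R T L RT TL) QQ QR LQ (balanced_pure R T L RT TL))"
proof -
  have ops: "triad_operations L T R TT TL RT LR QQ QR LQ"
    if "Q0_operations L T R TL RT LR QQ QR LQ" for QQ QR LQ
    by (intro triad_operations.intro triad_operations_axioms.intro assms that)
  show ?thesis
  proof (intro conjI)
    show "\<exists>QQ QR LQ. Q0_operations L T R TL RT LR QQ QR LQ"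
      by (rule quantum_triad.operations_exist[OF assms])
  next
    show "\<forall>QQ QR LQ QQ' QR' LQ'.
       Q0_operations L T R TL RT LR QQ QR LQ \<and> Q0_operations L T R TL RT LR QQ' QR' LQ' \<longrightarrow>
       (\<forall>p\<in>carrier (balanced_tensor R T L RT TL). \<forall>q\<in>carrier (balanced_tensor R T L RT TL).
          QQ p q = QQ' p q) \<and>
       (\<forall>q\<in>carrier (balanced_tensor R T L RT TL). \<forall>r\<in>carrier R. QR q r = QR' q r) \<and>
       (\<forall>l\<in>carrier L. \<forall>q\<in>carrier (balanced_tensor R T L RT TL). LQ l q = LQ' l q)"
    proof (intro allI impI)
      fix QQ QR LQ QQ' QR' LQ'
      assume "Q0_operations L T R TL RT LR QQ QR LQ \<and> Q0_operations L T R TL RT LR QQ' QR' LQ'"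
      then have o1: "Q0_operations L T R TL RT LR QQ QR LQ"
        and o2: "Q0_operations L T R TL RT LR QQ' QR' LQ'"
        by (rule conjunct1, rule conjunct2)
      note unique = triad_operations.operations_unique[OF ops[OF o1] o2]
      show "(\<forall>p\<in>carrier (balanced_tensor R T L RT TL). \<forall>q\<in>carrier (balanced_tensor R T L RT TL).
          QQ p q = QQ' p q) \<and>
       (\<forall>q\<in>carrier (balanced_tensor R T L RT TL). \<forall>r\<in>carrier R. QR q r = QR' q r) \<and>
       (\<forall>l\<in>carrier L. \<forall>q\<in>carrier (balanced_tensor R T L RT TL). LQ l q = LQ' l q)"
        by (intro conjI ballI unique)
    qed
  next
    show "\<forall>QQ QR LQ. Q0_operations L T R TL RT LR QQ QR LQ \<longrightarrow>
       triad_solution L T R TT TL RT LR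
         (balanced_tensor R T L RT TL) QQ QR LQ (balanced_pure R T L RT TL)"
      by (intro allI impI triad_operations.solution ops)
  qed
qed

end
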